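(* For all integers $n,t,k\ge 1$ and for every field $\mathbb{F}$, the following holds. If there exists a collection of $m = k \cdot (t-1) +1$ nonzero vectors in $\mathbb{F}^n$ satisfying that every $t$ of them span the entire space $\mathbb{F}^{n}$, then the graph $K_{k,m}$ is not $(n,k)$-subspace choosable over $\mathbb{F}$.
   Context: Inner product: on $\mathbb{C}^s$, $\langle x,y\rangle=\sum_i x_i\overline{y_i}$; on $\mathbb{F}^s$ for every other field $\mathbb{F}$ (in particular $\mathbb{R}$ and finite fields), $\langle x,y\rangle=\sum_i x_iy_i$. For a finite simple graph $G=(V,E)$ and a function $f$ from $V$ to the positive integers, $G$ is $f$-subspace choosable over a field $\mathbb{F}$ if for every integer $s$ and every assignment of subspaces $W_v\subseteq\mathbb{F}^s$ with $\dim(W_v)=f(v)$ to the vertices $v\in V$, there exists a choice of a nonzero vector $x_v\in W_v$ for each $v\in V$ such that $\langle x_v,x_{v'}\rangle=0$ whenever $v$ and $v'$ are adjacent in $G$. The complete bipartite graph $K_{\ell_1,\ell_2}$, with vertex set $A$ of size $\ell_1$ on the left side and vertex set $B$ of size $\ell_2$ on the right side, is $(k_1,k_2)$-subspace choosable over $\mathbb{F}$ if it is $f$-subspace choosable over $\mathbb{F}$ for the function $f$ with $f(u)=k_1$ for every $u\in A$ and $f(u)=k_2$ for every $u\in B$. *)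

theory Defs
  imports "Jordan_Normal_Form.VS_Connect" "Graph_Theory.Graph_Theory"
begin

definition spans_space :: "nat \<Rightarrow> 'a :: field vec set \<Rightarrow> bool" where
  "spans_space n S \<longleftrightarrow>
     LinearCombinations.module.span class_ring (module_vec TYPE('a) n) S = carrier_vec n"

definition is_subspace_of_dim :: "nat \<Rightarrow> 'a :: field vec set \<Rightarrow> nat \<Rightarrow> bool" where
  "is_subspace_of_dim s W d \<longleftrightarrow>
     VectorSpace.subspace class_ring W (module_vec TYPE('a) s) \<and>
     vectorspace.dim class_ring ((module_vec TYPE('a) s)\<lparr>carrier := W\<rparr>) = d"

(* The collection is an indexed family v 0, ..., v (m - 1), so repetitions are allowed, and
   "every t of them" ranges over the t-element sets of indices. *)
definition every_t_span :: "nat \<Rightarrow> nat \<Rightarrow> nat \<Rightarrow> (nat \<Rightarrow> 'a :: field vec) \<Rightarrow> bool" where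
  "every_t_span n m t v \<longleftrightarrow>
     (\<forall>j<m. v j \<in> carrier_vec n \<and> v j \<noteq> 0\<^sub>v n) \<and>
     (\<forall>T. T \<subseteq> {..<m} \<and> card T = t \<longrightarrow> spans_space n (v ` T))"

(* ip is the inner product in use: the convention differs between the complex field and all other
   fields, and a single definition over the class field cannot tell them apart.
   A finite simple graph is a pair_graph: a finite, loop-free, symmetric set of arcs. *)
definition subspace_choosable_wrt ::
  "('a :: field vec \<Rightarrow> 'a vec \<Rightarrow> 'a) \<Rightarrow> 'v pair_pre_digraph \<Rightarrow> ('v \<Rightarrow> nat) \<Rightarrow> bool" where
  "subspace_choosable_wrt ip G f \<longleftrightarrow>
     (\<forall>s. \<forall>W :: 'v \<Rightarrow> 'a vec set.
        (\<forall>u \<in> pverts G. is_subspace_of_dim s (W u) (f u)) \<longrightarrow>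
        (\<exists>x. (\<forall>u \<in> pverts G. x u \<in> W u \<and> x u \<noteq> 0\<^sub>v s) \<and>
             (\<forall>(u, w) \<in> parcs G. ip (x u) (x w) = 0)))"

(* The notion for every field other than the complex numbers; over complex it is the bilinear
   variant, and subspace_choosable_complex is the notion with the Hermitian product. *)
definition subspace_choosable ::
  "'a :: field itself \<Rightarrow> 'v pair_pre_digraph \<Rightarrow> ('v \<Rightarrow> nat) \<Rightarrow> bool" where
  "subspace_choosable _ = subspace_choosable_wrt ((\<bullet>) :: 'a vec \<Rightarrow> 'a vec \<Rightarrow> 'a)"

definition subspace_choosable_complex :: "'v pair_pre_digraph \<Rightarrow> ('v \<Rightarrow> nat) \<Rightarrow> bool" where
  "subspace_choosable_complex =
     subspace_choosable_wrt ((\<bullet>c) :: complex vec \<Rightarrow> complex vec \<Rightarrow> complex)"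

definition complete_bipartite :: "nat \<Rightarrow> nat \<Rightarrow> (nat + nat) pair_pre_digraph" where
  "complete_bipartite l1 l2 =
     (let A = Inl ` {..<l1}; B = Inr ` {..<l2}
      in \<lparr>pverts = A \<union> B, parcs = A \<times> B \<union> B \<times> A\<rparr>)"

lemma complete_bipartite_digraph_complete_bipartite:
  "complete_bipartite_digraph l1 l2 (with_proj (complete_bipartite l1 l2))"
  unfolding complete_bipartite_digraph_pair_def
proof (intro conjI exI)
  show "card (Inl ` {..<l1} :: (nat + nat) set) = l1" "card (Inr ` {..<l2} :: (nat + nat) set) = l2"
    by (simp_all add: card_image)
qed (auto simp: complete_bipartite_def Let_def)

lemma pair_graph_complete_bipartite: "pair_graph (complete_bipartite l1 l2)"
  using complete_bipartite_digraph_complete_bipartite by (rule pair_graphI_complete_bipartite)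

lemma complex_inner_product_eq:
  fixes x y :: "complex vec"
  assumes "x \<in> carrier_vec s" "y \<in> carrier_vec s"
  shows "x \<bullet>c y = (\<Sum>i<s. x $ i * cnj (y $ i))"
  using assms by (auto simp: scalar_prod_def lessThan_atLeast0 intro!: sum.cong)

definition bipartite_sizes :: "nat \<Rightarrow> nat \<Rightarrow> nat + nat \<Rightarrow> nat" where
  "bipartite_sizes k1 k2 = case_sum (\<lambda>_. k1) (\<lambda>_. k2)"

end

theory Submission
  imports Defs
begin

text \<open>
  Let \<open>v\<^sub>0, \<dots>, v\<^sub>m\<^sub>-\<^sub>1\<close> be the given vectors of \<open>F\<^sup>n\<close>. The bad assignment of subspaces lives in
  \<open>F\<^sup>k \<otimes> F\<^sup>n\<close>, which is the space of dimension \<open>s = k n\<close>: the \<open>i\<close>-th vertex on the left receives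
  \<open>e\<^sub>i \<otimes> F\<^sup>n\<close> and the \<open>j\<close>-th vertex on the right receives \<open>F\<^sup>k \<otimes> v\<^sub>j\<close>. Their dimensions are \<open>n\<close> and \<open>k\<close>
  because tensoring with a fixed nonzero vector is linear and injective
  (\<open>injective_image_subspace_of_dim\<close>).

  Suppose that nonzero vectors \<open>e\<^sub>i \<otimes> y\<^sub>i\<close> and \<open>a\<^sub>j \<otimes> v\<^sub>j\<close> are chosen, orthogonal along all edges. The
  inner product is multiplicative on tensors (\<open>scalar_prod_vec_tensor\<close>), so that
  \<open>\<langle>e\<^sub>i, a\<^sub>j\<rangle> \<langle>y\<^sub>i, v\<^sub>j\<rangle> = 0\<close> for all \<open>i\<close> and \<open>j\<close>. As \<open>a\<^sub>j\<close> is nonzero, it has a nonzero coordinate \<open>i\<close>, and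
  then \<open>y\<^sub>i\<close> is orthogonal to \<open>v\<^sub>j\<close>. There are more than \<open>k (t - 1)\<close> indices \<open>j\<close> and only \<open>k\<close> values of
  \<open>i\<close>, so by the pigeonhole principle some \<open>y\<^sub>i\<close> is orthogonal to \<open>t\<close> of the \<open>v\<^sub>j\<close>. These span \<open>F\<^sup>n\<close>,
  whence \<open>y\<^sub>i = 0\<close> (\<open>orthogonal_to_spanning_set_eq_0\<close>), a contradiction.

  The bilinear and the Hermitian inner product are treated at once: both have the form
  \<open>x \<bullet> map_vec \<sigma> y\<close> for a field endomorphism \<open>\<sigma>\<close>, namely the identity and complex conjugation.
\<close>

section \<open>Subspaces given by injective linear maps\<close>

text \<open>The same map is used twice: into \<open>F\<^sup>s\<close>, where its image is a subspace, and onto that image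
  as a space of its own, where bijectivity transports the dimension.\<close>

lemma injective_image_subspace_of_dim:
  fixes f :: "'a :: field vec \<Rightarrow> 'a vec"
  assumes carrier: "\<And>x. x \<in> carrier_vec d \<Longrightarrow> f x \<in> carrier_vec s"
    and add: "\<And>x y. x \<in> carrier_vec d \<Longrightarrow> y \<in> carrier_vec d \<Longrightarrow> f (x + y) = f x + f y"
    and smult: "\<And>c x. x \<in> carrier_vec d \<Longrightarrow> f (c \<cdot>\<^sub>v x) = c \<cdot>\<^sub>v f x"
    and inj: "inj_on f (carrier_vec d)"
  shows "is_subspace_of_dim s (f ` carrier_vec d) d"
proof -
  let ?K = "class_ring :: 'a ring"
  let ?V = "module_vec TYPE('a) d" and ?W = "module_vec TYPE('a) s"
  let ?I = "?W\<lparr>carrier := f ` carrier_vec d\<rparr>"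
  interpret V: vec_space "TYPE('a)" d .
  have V: "vectorspace ?K ?V" and W: "vectorspace ?K ?W"
    by (rule vec_vs)+
  have hom: "f \<in> LinearCombinations.module_hom ?K ?V ?W"
    using carrier add smult by (auto simp: LinearCombinations.module_hom_def module_vec_simps)
  have "linear_map ?K ?V ?W f"
    using V W hom by (simp add: linear_map_def mod_hom_def mod_hom_axioms_def vectorspace_def)
  then interpret f: linear_map ?K ?V ?W f .
  have im: "f.imT = f ` carrier_vec d"
    by (simp add: f.im_def module_vec_simps)
  have sub: "VectorSpace.subspace ?K (f ` carrier_vec d) ?W"
    using f.imT_is_subspace by (simp only: im)
  have I: "vectorspace ?K ?I"
    by (rule vectorspace.subspace_is_vs[OF W sub])
  have hom_I: "f \<in> LinearCombinations.module_hom ?K ?V ?I"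
    using add smult by (auto simp: LinearCombinations.module_hom_def module_vec_simps)
  have "linear_map ?K ?V ?I f"
    using V I hom_I by (simp add: linear_map_def mod_hom_def mod_hom_axioms_def vectorspace_def)
  then have "vectorspace.dim ?K ?V = vectorspace.dim ?K ?I"
    by (rule linear_map.dim_eq) (use V.fin_dim inj in \<open>simp_all add: module_vec_simps\<close>)
  then show ?thesis
    using sub V.dim_is_n by (simp add: is_subspace_of_dim_def)
qed

section \<open>Tensor products of coordinate vectors\<close>

text \<open>The coordinates of a tensor in \<open>F\<^sup>k \<otimes> F\<^sup>n\<close> are listed block by block: the pair \<open>(i, l)\<close> with
  \<open>i < k\<close> and \<open>l < n\<close> becomes the index \<open>i n + l\<close>.\<close>

definition vec_tensor :: "'a :: times vec \<Rightarrow> 'a vec \<Rightarrow> 'a vec" where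
  "vec_tensor a y =
     vec (dim_vec a * dim_vec y) (\<lambda>p. a $ (p div dim_vec y) * y $ (p mod dim_vec y))"

lemma vec_tensor_carrier [simp]:
  "a \<in> carrier_vec k \<Longrightarrow> y \<in> carrier_vec n \<Longrightarrow> vec_tensor a y \<in> carrier_vec (k * n)"
  by (auto simp: vec_tensor_def)

lemma block_index_less:
  fixes i k l n :: nat
  assumes "i < k" "l < n"
  shows "i * n + l < k * n"
proof -
  have "i * n + l < Suc i * n" using assms by simp
  also have "\<dots> \<le> k * n" using assms by (intro mult_le_mono1) simp
  finally show ?thesis .
qed

lemma block_div_less:
  fixes k n p :: nat
  shows "p < k * n \<Longrightarrow> p div n < k"
  by (simp add: less_mult_imp_div_less)

lemma block_mod_less:
  fixes k n p :: nat
  shows "p < k * n \<Longrightarrow> p mod n < n"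
  by (cases "n = 0") auto

lemma vec_tensor_index:
  assumes "a \<in> carrier_vec k" "y \<in> carrier_vec n" "i < k" "l < n"
  shows "vec_tensor a y $ (i * n + l) = a $ i * y $ l"
  using assms block_index_less[of i k l n] by (simp add: vec_tensor_def carrier_vecD)

lemma vec_tensor_add_left:
  fixes a b y :: "'a :: semiring_0 vec"
  assumes "a \<in> carrier_vec k" "b \<in> carrier_vec k"
  shows "vec_tensor (a + b) y = vec_tensor a y + vec_tensor b y"
  using assms
  by (intro eq_vecI) (auto simp: vec_tensor_def carrier_vecD block_div_less distrib_right)

lemma vec_tensor_add_right:
  fixes a y z :: "'a :: semiring_0 vec"
  assumes "y \<in> carrier_vec n" "z \<in> carrier_vec n"
  shows "vec_tensor a (y + z) = vec_tensor a y + vec_tensor a z"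
  using assms
  by (intro eq_vecI) (auto simp: vec_tensor_def carrier_vecD block_mod_less distrib_left)

lemma vec_tensor_smult_left:
  fixes a y :: "'a :: semigroup_mult vec"
  shows "vec_tensor (c \<cdot>\<^sub>v a) y = c \<cdot>\<^sub>v vec_tensor a y"
  by (intro eq_vecI) (auto simp: vec_tensor_def block_div_less mult.assoc)

lemma vec_tensor_smult_right:
  fixes a y :: "'a :: ab_semigroup_mult vec"
  shows "vec_tensor a (c \<cdot>\<^sub>v y) = c \<cdot>\<^sub>v vec_tensor a y"
  by (intro eq_vecI) (auto simp: vec_tensor_def block_mod_less mult.left_commute)

lemma nonzero_vec_has_nonzero_coordinate:
  assumes "a \<in> carrier_vec k" "a \<noteq> 0\<^sub>v k"
  obtains i where "i < k" "a $ i \<noteq> 0"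
  using assms by (metis carrier_vecD eq_vecI index_zero_vec)

lemma inj_on_vec_tensor_right:
  fixes a :: "'a :: idom vec"
  assumes a: "a \<in> carrier_vec k" "a \<noteq> 0\<^sub>v k"
  shows "inj_on (vec_tensor a) (carrier_vec n)"
proof (rule inj_onI)
  fix y z :: "'a vec"
  assume y: "y \<in> carrier_vec n" and z: "z \<in> carrier_vec n" and eq: "vec_tensor a y = vec_tensor a z"
  obtain i where i: "i < k" "a $ i \<noteq> 0"
    using nonzero_vec_has_nonzero_coordinate[OF a] .
  have "y $ l = z $ l" if "l < n" for l
    using vec_tensor_index[OF a(1) y i(1) that] vec_tensor_index[OF a(1) z i(1) that] eq i(2) by simp
  then show "y = z" using y z by (intro eq_vecI) (auto simp: carrier_vecD)
qed

lemma inj_on_vec_tensor_left: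
  fixes y :: "'a :: idom vec"
  assumes y: "y \<in> carrier_vec n" "y \<noteq> 0\<^sub>v n"
  shows "inj_on (\<lambda>a. vec_tensor a y) (carrier_vec k)"
proof (rule inj_onI)
  fix a b :: "'a vec"
  assume a: "a \<in> carrier_vec k" and b: "b \<in> carrier_vec k" and eq: "vec_tensor a y = vec_tensor b y"
  obtain l where l: "l < n" "y $ l \<noteq> 0"
    using nonzero_vec_has_nonzero_coordinate[OF y] .
  have "a $ i = b $ i" if "i < k" for i
    using vec_tensor_index[OF a y(1) that l(1)] vec_tensor_index[OF b y(1) that l(1)] eq l(2) by simp
  then show "a = b" using a b by (intro eq_vecI) (auto simp: carrier_vecD)
qed

lemma vec_tensor_zero_left:
  fixes y :: "'a :: mult_zero vec"
  assumes "y \<in> carrier_vec n"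
  shows "vec_tensor (0\<^sub>v k) y = 0\<^sub>v (k * n)"
  using assms by (intro eq_vecI) (auto simp: vec_tensor_def carrier_vecD block_div_less)

lemma vec_tensor_zero_right:
  fixes a :: "'a :: mult_zero vec"
  assumes "a \<in> carrier_vec k"
  shows "vec_tensor a (0\<^sub>v n) = 0\<^sub>v (k * n)"
  using assms by (intro eq_vecI) (auto simp: vec_tensor_def carrier_vecD block_mod_less)

lemma map_vec_tensor:
  assumes "\<And>x y. h (x * y) = h x * h y"
  shows "map_vec h (vec_tensor a y) = vec_tensor (map_vec h a) (map_vec h y)"
  using assms by (intro eq_vecI) (auto simp: vec_tensor_def block_div_less block_mod_less)

text \<open>Summing over the blocks first separates the double sum over the pairs \<open>(i, l)\<close> into a product
  of two sums.\<close>

lemma scalar_prod_vec_tensor: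
  fixes a b y z :: "'a :: comm_semiring_0 vec"
  assumes "a \<in> carrier_vec k" "b \<in> carrier_vec k" "y \<in> carrier_vec n" "z \<in> carrier_vec n"
  shows "vec_tensor a y \<bullet> vec_tensor b z = (a \<bullet> b) * (y \<bullet> z)"
proof -
  let ?g = "\<lambda>p. vec_tensor a y $ p * vec_tensor b z $ p"
  have "vec_tensor a y \<bullet> vec_tensor b z = (\<Sum>p<k * n. ?g p)"
    using carrier_vecD[OF vec_tensor_carrier[OF assms(2,4)]]
    by (simp add: scalar_prod_def lessThan_atLeast0)
  also have "\<dots> = (\<Sum>i<k. \<Sum>p = i * n..<i * n + n. ?g p)"
    by (rule sum.nat_group[symmetric])
  also have "\<dots> = (\<Sum>i<k. \<Sum>l<n. (a $ i * b $ i) * (y $ l * z $ l))"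
  proof (rule sum.cong[OF refl])
    fix i assume "i \<in> {..<k}"
    then have i: "i < k" by simp
    have "(\<Sum>p = i * n..<i * n + n. ?g p) = (\<Sum>l<n. ?g (i * n + l))"
      using sum.shift_bounds_nat_ivl[of ?g 0 "i * n" n]
      by (simp add: lessThan_atLeast0 add.commute)
    also have "\<dots> = (\<Sum>l<n. (a $ i * b $ i) * (y $ l * z $ l))"
      using assms i by (intro sum.cong) (simp_all add: vec_tensor_index mult_ac)
    finally show "(\<Sum>p = i * n..<i * n + n. ?g p) = \<dots>" .
  qed
  also have "\<dots> = (a \<bullet> b) * (y \<bullet> z)"
    using assms by (simp add: scalar_prod_def lessThan_atLeast0 sum_product carrier_vecD)
  finally show ?thesis .
qed

section \<open>Orthogonality to a spanning set\<close>

text \<open>The vectors that are orthogonal to \<open>y\<close> form a subspace. If it contains a spanning set, then it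
  contains the unit vectors, and these read off the coordinates of \<open>y\<close>.\<close>

lemma orthogonal_to_spanning_set_eq_0:
  fixes \<sigma> :: "'a :: field \<Rightarrow> 'a"
  assumes \<sigma>: "field_hom \<sigma>" and S: "S \<subseteq> carrier_vec n" "spans_space n S"
    and y: "y \<in> carrier_vec n" and orth: "\<And>w. w \<in> S \<Longrightarrow> y \<bullet> map_vec \<sigma> w = 0"
  shows "y = 0\<^sub>v n"
proof -
  interpret \<sigma>: field_hom \<sigma> by (fact \<sigma>)
  interpret vec_space "TYPE('a)" n .
  let ?N = "{w \<in> carrier_vec n. y \<bullet> map_vec \<sigma> w = 0}"
  have "submodule class_ring ?N V"
  proof
    show "\<zero>\<^bsub>V\<^esub> \<in> ?N"
      using y by (auto simp: scalar_prod_def)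
    show "w \<oplus>\<^bsub>V\<^esub> u \<in> ?N" if "w \<in> ?N" "u \<in> ?N" for w u
    proof -
      have "map_vec \<sigma> (w + u) = map_vec \<sigma> w + map_vec \<sigma> u"
        using that by (intro eq_vecI) (auto simp: carrier_vecD \<sigma>.hom_add)
      then show ?thesis
        using that y by (simp add: scalar_prod_add_distrib[of _ n])
    qed
    show "c \<odot>\<^bsub>V\<^esub> w \<in> ?N" if "c \<in> carrier class_ring" "w \<in> ?N" for c w
    proof -
      have "map_vec \<sigma> (c \<cdot>\<^sub>v w) = \<sigma> c \<cdot>\<^sub>v map_vec \<sigma> w"
        by (intro eq_vecI) (auto simp: \<sigma>.hom_mult)
      then show ?thesis
        using that y by simp
    qed
  qed auto
  moreover have "S \<subseteq> ?N" using S(1) orth by auto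
  ultimately have "span S \<subseteq> ?N" by (rule span_is_subset[rotated])
  then have all: "carrier_vec n \<subseteq> ?N"
    using S(2) by (simp add: spans_space_def)
  have "y $ l = 0" if l: "l < n" for l
  proof -
    have "map_vec \<sigma> (unit_vec n l) = unit_vec n l"
      using l by (intro eq_vecI) (auto simp: unit_vec_def)
    moreover have "y \<bullet> map_vec \<sigma> (unit_vec n l) = 0"
      using all unit_vec_carrier[of n l] by blast
    ultimately show ?thesis using y l by simp
  qed
  then show ?thesis using y by (intro eq_vecI) (auto simp: carrier_vecD)
qed

section \<open>The assignment without an orthogonal choice\<close>

text \<open>A nonzero \<open>a\<^sub>j\<close> may have a single nonzero coordinate, so each \<open>v\<^sub>j\<close> is only guaranteed to be
  orthogonal to one \<open>y\<^sub>i\<close>. This is why the count needs \<open>m\<close> to exceed \<open>k\<close> times \<open>t - 1\<close>, the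
  largest number of \<open>v\<^sub>j\<close> to which one nonzero \<open>y\<^sub>i\<close> can be orthogonal.\<close>

lemma not_subspace_choosable_wrt_if_every_t_span:
  fixes \<sigma> :: "'a :: field \<Rightarrow> 'a" and v :: "nat \<Rightarrow> 'a vec"
  assumes \<sigma>: "field_hom \<sigma>" and span: "every_t_span n m t v" and m: "k * (t - 1) < m"
  shows "\<not> subspace_choosable_wrt (\<lambda>x y. x \<bullet> map_vec \<sigma> y)
            (complete_bipartite k m) (bipartite_sizes n k)"
proof
  assume choosable: "subspace_choosable_wrt (\<lambda>x y. x \<bullet> map_vec \<sigma> y)
            (complete_bipartite k m) (bipartite_sizes n k)"
  interpret \<sigma>: field_hom \<sigma> by (fact \<sigma>)
  have v: "v j \<in> carrier_vec n" "v j \<noteq> 0\<^sub>v n" if "j < m" for j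
    using span that by (auto simp: every_t_span_def)
  have unit: "unit_vec k i \<in> carrier_vec k" "unit_vec k i \<noteq> (0\<^sub>v k :: 'a vec)" if "i < k" for i
    using that by (auto simp: unit_vec_nonzero)
  define W :: "nat + nat \<Rightarrow> 'a vec set" where
    "W = case_sum (\<lambda>i. vec_tensor (unit_vec k i) ` carrier_vec n)
                  (\<lambda>j. (\<lambda>a. vec_tensor a (v j)) ` carrier_vec k)"
  have left: "is_subspace_of_dim (k * n) (W (Inl i)) n" if "i < k" for i
    unfolding W_def sum.case using unit[OF that]
    by (intro injective_image_subspace_of_dim inj_on_vec_tensor_right)
       (auto simp: vec_tensor_add_right vec_tensor_smult_right)
  have right: "is_subspace_of_dim (k * n) (W (Inr j)) k" if "j < m" for j
    unfolding W_def sum.case using v[OF that]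
    by (intro injective_image_subspace_of_dim inj_on_vec_tensor_left)
       (auto simp: vec_tensor_add_left vec_tensor_smult_left)
  have "\<forall>u \<in> pverts (complete_bipartite k m).
          is_subspace_of_dim (k * n) (W u) (bipartite_sizes n k u)"
    using left right by (auto simp: complete_bipartite_def Let_def bipartite_sizes_def)
  then obtain x where
    x: "\<forall>u \<in> pverts (complete_bipartite k m). x u \<in> W u \<and> x u \<noteq> 0\<^sub>v (k * n)" and
    orth: "\<forall>(u, w) \<in> parcs (complete_bipartite k m). x u \<bullet> map_vec \<sigma> (x w) = 0"
    using choosable unfolding subspace_choosable_wrt_def by blast
  have "\<exists>y. y \<in> carrier_vec n \<and> y \<noteq> 0\<^sub>v n \<and> x (Inl i) = vec_tensor (unit_vec k i) y"
    if "i < k" for i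
  proof -
    have "x (Inl i) \<in> W (Inl i)" "x (Inl i) \<noteq> 0\<^sub>v (k * n)"
      using x that by (auto simp: complete_bipartite_def Let_def)
    then show ?thesis
      using vec_tensor_zero_right[OF unit(1)[OF that], of n] by (auto simp: W_def)
  qed
  then obtain y where
    y: "\<And>i. i < k \<Longrightarrow> y i \<in> carrier_vec n" "\<And>i. i < k \<Longrightarrow> y i \<noteq> 0\<^sub>v n"
       "\<And>i. i < k \<Longrightarrow> x (Inl i) = vec_tensor (unit_vec k i) (y i)"
    by metis
  have covered: "\<exists>i<k. y i \<bullet> map_vec \<sigma> (v j) = 0" if j: "j < m" for j
  proof -
    have "x (Inr j) \<in> W (Inr j)" "x (Inr j) \<noteq> 0\<^sub>v (k * n)"
      using x j by (auto simp: complete_bipartite_def Let_def)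
    then obtain a where a: "a \<in> carrier_vec k" "a \<noteq> 0\<^sub>v k" "x (Inr j) = vec_tensor a (v j)"
      using vec_tensor_zero_left[OF v(1)[OF j], of k] unfolding W_def sum.case by (metis imageE)
    obtain i where i: "i < k" "a $ i \<noteq> 0"
      using nonzero_vec_has_nonzero_coordinate[OF a(1,2)] .
    have "x (Inl i) \<bullet> map_vec \<sigma> (x (Inr j)) = 0"
      using orth i(1) j by (auto simp: complete_bipartite_def Let_def)
    then have "vec_tensor (unit_vec k i) (y i) \<bullet> vec_tensor (map_vec \<sigma> a) (map_vec \<sigma> (v j)) = 0"
      by (simp add: y(3)[OF i(1)] a(3) map_vec_tensor \<sigma>.hom_mult)
    then have "(unit_vec k i \<bullet> map_vec \<sigma> a) * (y i \<bullet> map_vec \<sigma> (v j)) = 0"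
      using a(1) v(1)[OF j] y(1)[OF i(1)] by (simp add: scalar_prod_vec_tensor[of _ k _ _ n])
    moreover have "unit_vec k i \<bullet> map_vec \<sigma> a = \<sigma> (a $ i)"
      using a(1) i(1) by simp
    ultimately show ?thesis using i by auto
  qed
  \<comment> \<open>The sets \<open>B i\<close> for \<open>i < k\<close> cover all \<open>m\<close> indices, so one of them has at least \<open>t\<close> elements.\<close>
  define B where "B i = {j. j < m \<and> y i \<bullet> map_vec \<sigma> (v j) = 0}" for i
  have "\<exists>i<k. t \<le> card (B i)"
  proof (rule ccontr)
    assume "\<not> ?thesis"
    then have small: "card (B i) \<le> t - 1" if "i < k" for i
      using that by force
    have "{..<m} \<subseteq> (\<Union>i<k. B i)"
      using covered by (auto simp: B_def)
    then have "m \<le> card (\<Union>i<k. B i)"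
      using card_mono[of "\<Union>i<k. B i" "{..<m}"] by (simp add: B_def)
    also have "\<dots> \<le> (\<Sum>i<k. card (B i))"
      by (rule card_UN_le) simp
    also have "\<dots> \<le> (\<Sum>i<k. t - 1)"
      using small by (intro sum_mono) simp
    finally show False using m by simp
  qed
  then obtain i T where i: "i < k" and T: "T \<subseteq> B i" "card T = t"
    by (metis obtain_subset_with_card_n)
  have "spans_space n (v ` T)"
    using span T by (auto simp: every_t_span_def B_def)
  then have "y i = 0\<^sub>v n"
    by (rule orthogonal_to_spanning_set_eq_0[OF \<sigma>, rotated])
       (use T(1) v(1) y(1)[OF i] in \<open>auto simp: B_def\<close>)
  then show False using y(2)[OF i] by simp
qed

lemma field_hom_cnj: "field_hom cnj"
  by unfold_locales auto

lemma field_hom_id: "field_hom (\<lambda>x. x)"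
  by unfold_locales auto

lemma conjugate_vec_eq_map_vec: "conjugate y = map_vec cnj y"
  for y :: "complex vec"
  by (intro eq_vecI) auto

theorem theorem5p7:
  fixes n t k m :: nat
  assumes "n \<ge> 1" and "t \<ge> 1" and "k \<ge> 1"
    and "m = k * (t - 1) + 1"
  shows "((\<exists>v :: nat \<Rightarrow> 'a :: field vec. every_t_span n m t v) \<longrightarrow>
           \<not> subspace_choosable TYPE('a) (complete_bipartite k m) (bipartite_sizes n k)) \<and>
         ((\<exists>v :: nat \<Rightarrow> complex vec. every_t_span n m t v) \<longrightarrow>
           \<not> subspace_choosable_complex (complete_bipartite k m) (bipartite_sizes n k))"
proof (intro conjI impI; elim exE)
  have m: "k * (t - 1) < m" using assms by simp
  show "\<not> subspace_choosable TYPE('a) (complete_bipartite k m) (bipartite_sizes n k)"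
    if "every_t_span n m t v" for v :: "nat \<Rightarrow> 'a vec"
  proof -
    have "map_vec (\<lambda>x. x) y = y" for y :: "'a vec"
      by (intro eq_vecI) auto
    then show ?thesis
      using not_subspace_choosable_wrt_if_every_t_span[OF field_hom_id that m]
      by (simp add: subspace_choosable_def)
  qed
  show "\<not> subspace_choosable_complex (complete_bipartite k m) (bipartite_sizes n k)"
    if "every_t_span n m t v" for v :: "nat \<Rightarrow> complex vec"
    using not_subspace_choosable_wrt_if_every_t_span[OF field_hom_cnj that m]
    by (simp add: subspace_choosable_complex_def conjugate_vec_eq_map_vec)
qed

end
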